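(* For all positive integers $d\le n$ we have \begin{equation*} A_1(2n,d)=\zeta(\overline{2n})-\sum_{j=0}^{\lfloor(d-2)/2 \rfloor}\sum_{k=0}^{2j+1} \frac{(-1)^{d+j+k}}{(2j+1)!}\binom{2j+1}{k} \binom{(k-3)/2}{d-1} \zeta(2n-2j)\,\pi^{2j}. \end{equation*}
   Context: For positive integers $s_1,\dots,s_d$ and signs $\varepsilon_1,\dots,\varepsilon_d\in\{1,-1\}$ with $(s_1,\varepsilon_1)\ne(1,1)$, the (alternating) Euler sum is $$\zeta(s_1,\dots,s_d;\varepsilon_1,\dots,\varepsilon_d)=\sum_{n_1>\cdots>n_d\ge 1}\frac{\varepsilon_1^{n_1}\cdots \varepsilon_d^{n_d}}{ n_1^{s_1}\cdots n_d^{s_d}}.$$ For integers $0\le\alpha\le d\le n$, $$A_\alpha(2n,d)=\sum \zeta(2j_1,\dots,2j_d;\varepsilon_1,\dots,\varepsilon_d),$$ where the sum is over all positive integers $j_1,\dots,j_d$ with $j_1+\cdots+j_d=n$ and all $(\varepsilon_1,\dots,\varepsilon_d)\in\{1,-1\}^d$ with exactly $\alpha$ of the $\varepsilon_\ell$ equal to $-1$. Thus $A_1$ is the sum over Euler sums with exactly one alternating component. Also $\zeta(m)$ is the Riemann zeta value and $\zeta(\overline{m})=\sum_{k\ge1}(-1)^k k^{-m}$. For real $x$ and integer $m\ge0$, $\binom{x}{m}=x(x-1)\cdots(x-m+1)/m!$. Empty sums are $0$. *)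

theory Defs
  imports "HOL-Analysis.Analysis"
begin

definition decreasing_tuples :: "nat \<Rightarrow> nat \<Rightarrow> nat list set" where
  "decreasing_tuples d N = {ns. length ns = d \<and> sorted_wrt (>) ns \<and> set ns \<subseteq> {1..N}}"

text \<open>
  The Euler sum for exponents \<open>ss = [s\<^sub>1, \<dots>, s\<^sub>d]\<close> (positive) and signs \<open>es = [\<epsilon>\<^sub>1, \<dots>, \<epsilon>\<^sub>d]\<close>
  (in \<open>{1, -1}\<close>), both of length \<open>d\<close>. The infinite nested sum is the limit of its truncations to
  outermost index \<open>n\<^sub>1 \<le> N\<close>: for \<open>s\<^sub>1 = 1\<close>, \<open>\<epsilon>\<^sub>1 = -1\<close> it converges only conditionally, so unordered
  summation over all tuples is not appropriate. The value is meaningful only if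
  \<open>(s\<^sub>1, \<epsilon>\<^sub>1) \<noteq> (1, 1)\<close>.
\<close>

definition euler_sum :: "nat list \<Rightarrow> real list \<Rightarrow> real" where
  "euler_sum ss es =
     lim (\<lambda>N. \<Sum>ns \<in> decreasing_tuples (length ss) N.
       \<Prod>i<length ss. (es ! i) ^ (ns ! i) / real (ns ! i) ^ (ss ! i))"

text \<open>
  \<open>A \<alpha> w d\<close> for even weight \<open>w = 2n\<close>: the sum runs over \<open>j\<^sub>1 + \<dots> + j\<^sub>d = n\<close> with all \<open>j\<^sub>i\<close> positive,
  and over sign vectors with exactly \<open>\<alpha>\<close> entries equal to \<open>-1\<close>.
\<close>

definition euler_A :: "nat \<Rightarrow> nat \<Rightarrow> nat \<Rightarrow> real" where
  "euler_A \<alpha> w d =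
     (\<Sum>js \<in> {js. length js = d \<and> (\<forall>j\<in>set js. 0 < j) \<and> 2 * sum_list js = w}.
      \<Sum>es \<in> {es. length es = d \<and> set es \<subseteq> {1, -1} \<and> count_list es (-1) = \<alpha>}.
        euler_sum (map (\<lambda>j. 2 * j) js) es)"

definition zeta_value :: "nat \<Rightarrow> real" where
  "zeta_value m = (\<Sum>k. 1 / real (Suc k) ^ m)"

definition zeta_bar :: "nat \<Rightarrow> real" where
  "zeta_bar m = (\<Sum>k. (-1) ^ Suc k / real (Suc k) ^ m)"

end

theory Submission
  imports Defs "HOL-Complex_Analysis.Cauchy_Integral_Formula"
begin

text \<open>
  Write \<open>t = x\<^sup>2\<close>, mark the weight \<open>2n\<close> by \<open>t\<^sup>n\<close> and the depth \<open>d\<close> by \<open>y\<^sup>d\<close>. Summing over all exponents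
  \<open>2j\<close> of an index \<open>k\<close> gives the factor \<open>t / (k\<^sup>2 - t)\<close>, so the generating function of the \<open>A\<^sub>1\<close> is
  \[ \sum_m (-1)^m \frac{yt}{m^2-t} \prod_{k \neq m} \Bigl(1 + \frac{yt}{k^2-t}\Bigr)
     = \frac{y}{1-y} \cdot \frac{P(ct)}{P(t)} \cdot R(ct), \qquad c = 1 - y, \]
  where \<open>P(t) = \<Prod>k. 1 - t/k\<^sup>2 = sin(\<pi>x)/(\<pi>x)\<close> and \<open>R(t) = \<Sum>m. (-1)\<^sup>m t/(m\<^sup>2-t)\<close>. The partial fraction
  expansion of the cosecant says \<open>1/P = 1 - 2R\<close>, hence \<open>P R = (P - 1)/2\<close>, and each
  \<open>A\<^sub>1(2n,d)\<close> is an explicit finite sum of coefficients of \<open>P\<close> and \<open>1/P\<close> (lemma \<open>euler_A_1_eq_sum\<close>).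

  To bring in the values \<open>\<zeta>(2n-2j)\<close>, put \<open>c = s\<^sup>2\<close> and use the addition theorem
  \[ \frac{\sin(\pi s x)}{\sin(\pi x)} = \cos(\pi (s-1) x) + \cot(\pi x) \sin(\pi (s-1) x), \]
  where \<open>\<pi>x cot(\<pi>x) = 1 - 2 \<Sum>r. \<zeta>(2r) x\<^sup>2\<^sup>r\<close>. Comparing coefficients of \<open>x\<close> leaves an identity between
  polynomials in \<open>s\<close> and polynomials in \<open>s - 1\<close> (lemma \<open>sine_quotient_expansion\<close>). Taking the
  coefficient of \<open>y\<^sup>d\<^sup>-\<^sup>1\<close> in \<open>s\<^sup>-\<^sup>3 f(s)\<close> with \<open>s = (1-y)\<^sup>1\<^sup>/\<^sup>2\<close> is, up to sign, the linear functional
  \<open>s\<^sup>k \<mapsto> ((k-3)/2 gchoose (d-1))\<close> on polynomials \<open>f\<close>; it produces the generalized binomial coefficients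
  of the theorem. Since \<open>s - 1\<close> is divisible by \<open>y\<close>, the functional kills \<open>(s-1)\<^sup>M\<close> for
  \<open>M \<ge> d\<close> (lemma \<open>alternating_binomial_sum_gchoose_eq_0\<close>). This removes the cosine term, where
  \<open>M = 2n \<ge> d\<close>, and cuts the sum over \<open>j\<close> at \<open>2j + 1 \<le> d - 1\<close>.

  All of this is carried out with formal power series over the reals. The generating function identity is
  first proved for indices bounded by \<open>N\<close>, as an identity of rational functions of \<open>t\<close>, and then
  \<open>N\<close> tends to infinity in each coefficient. The analytic input to this limit is the product formula of
  the sine and the convergence of the zeta series. The expansion of the cotangent is the logarithmic derivative of
  the product, and that of the cosecant follows from \<open>1 / sin(2a) = cot(a) - cot(2a)\<close>.
\<close>

unbundle no vec_syntax
unbundle fps_syntax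

section \<open>Truncated Euler sums\<close>

definition truncated_euler_sum :: "nat \<Rightarrow> nat list \<Rightarrow> real list \<Rightarrow> real" where
  "truncated_euler_sum N ss es =
     (\<Sum>ns \<in> decreasing_tuples (length ss) N.
       \<Prod>i<length ss. (es ! i) ^ (ns ! i) / real (ns ! i) ^ (ss ! i))"

lemma decreasing_tuples_0 [simp]: "decreasing_tuples 0 N = {[]}"
  by (auto simp: decreasing_tuples_def)

lemma decreasing_tuples_Suc_0 [simp]: "decreasing_tuples (Suc d) 0 = {}"
  by (auto simp: decreasing_tuples_def length_Suc_conv)

lemma finite_decreasing_tuples [simp, intro]: "finite (decreasing_tuples d N)"
  by (rule finite_subset[OF _ finite_lists_length_eq[of "{1..N}" d]])
     (auto simp: decreasing_tuples_def)

text \<open>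
  A decreasing tuple with entries up to \<open>N + 1\<close> can contain \<open>N + 1\<close> only in front. This
  is the basis of the inductions on the bound \<open>N\<close>.
\<close>

lemma decreasing_tuples_Suc_Suc:
  "decreasing_tuples (Suc d) (Suc N) =
     decreasing_tuples (Suc d) N \<union> (#) (Suc N) ` decreasing_tuples d N" (is "?L = ?A \<union> ?B")
proof (intro equalityI subsetI)
  fix xs assume xs: "xs \<in> ?L"
  then obtain m ns where m: "xs = m # ns"
    by (auto simp: decreasing_tuples_def length_Suc_conv)
  show "xs \<in> ?A \<union> ?B"
  proof (cases "m = Suc N")
    case True
    with xs m have "xs \<in> ?B" by (force simp: decreasing_tuples_def)
    thus ?thesis ..
  next
    case False
    with xs m have "xs \<in> ?A" by (force simp: decreasing_tuples_def)
    thus ?thesis ..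
  qed
qed (force simp: decreasing_tuples_def)+

lemma truncated_euler_sum_Nil [simp]: "truncated_euler_sum N [] es = 1"
  by (simp add: truncated_euler_sum_def)

lemma truncated_euler_sum_0_Cons [simp]: "truncated_euler_sum 0 (s # ss) es = 0"
  by (simp add: truncated_euler_sum_def)

lemma truncated_euler_sum_Suc_Cons:
  "truncated_euler_sum (Suc N) (s # ss) (e # es) =
     truncated_euler_sum N (s # ss) (e # es) +
     e ^ Suc N / real (Suc N) ^ s * truncated_euler_sum N ss es"
proof -
  let ?f = "\<lambda>ns. \<Prod>i<length (s # ss). ((e # es) ! i) ^ (ns ! i) / real (ns ! i) ^ ((s # ss) ! i)"
  let ?g = "\<lambda>ns. \<Prod>i<length ss. (es ! i) ^ (ns ! i) / real (ns ! i) ^ (ss ! i)"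
  let ?d = "length ss"
  have disj: "decreasing_tuples (Suc ?d) N \<inter> (#) (Suc N) ` decreasing_tuples ?d N = {}"
    by (auto simp: decreasing_tuples_def)
  have cons: "?f (Suc N # ns) = e ^ Suc N / real (Suc N) ^ s * ?g ns" for ns
    by (simp only: length_Cons prod.lessThan_Suc_shift) simp
  have "sum ?f (decreasing_tuples (Suc ?d) (Suc N)) =
          sum ?f (decreasing_tuples (Suc ?d) N) + sum ?f ((#) (Suc N) ` decreasing_tuples ?d N)"
    unfolding decreasing_tuples_Suc_Suc by (intro sum.union_disjoint disj) auto
  also have "sum ?f ((#) (Suc N) ` decreasing_tuples ?d N) =
               (\<Sum>ns\<in>decreasing_tuples ?d N. ?f (Suc N # ns))"
    by (subst sum.reindex) (auto simp: inj_on_def)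
  also have "\<dots> = e ^ Suc N / real (Suc N) ^ s * sum ?g (decreasing_tuples ?d N)"
    unfolding cons by (rule sum_distrib_left[symmetric])
  finally show ?thesis
    by (simp only: truncated_euler_sum_def length_Cons)
qed

lemma convergent_if_increments_le_inverse_square:
  fixes u :: "nat \<Rightarrow> real"
  assumes "\<And>N. \<bar>u (Suc N) - u N\<bar> \<le> B / real (Suc N) ^ 2"
  shows "convergent u"
proof -
  have "summable (\<lambda>N. B * (1 / real (Suc N) ^ 2))"
    using inverse_squares_sums by (intro summable_mult) (simp add: sums_iff add.commute)
  hence "summable (\<lambda>N. u (Suc N) - u N)"
    by (rule summable_comparison_test[rotated]) (use assms in auto)
  from summable_LIMSEQ[OF this] have "(\<lambda>N. u N - u 0) \<longlonglongrightarrow> (\<Sum>N. u (Suc N) - u N)"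
    by (simp only: sum_lessThan_telescope)
  hence "(\<lambda>N. (u N - u 0) + u 0) \<longlonglongrightarrow> (\<Sum>N. u (Suc N) - u N) + u 0"
    by (intro tendsto_intros)
  thus ?thesis by (auto simp: convergent_def)
qed

text \<open>
  Raising the bound to \<open>N + 1\<close> adds a term with factor \<open>1 / (N + 1)\<^sup>s\<close>, where \<open>s \<ge> 2\<close>, times a truncated
  sum of smaller depth, which is bounded by the induction hypothesis.
\<close>

lemma convergent_truncated_euler_sum:
  assumes "length es = length ss" "set es \<subseteq> {1, -1}" "\<forall>s\<in>set ss. 2 \<le> s"
  shows "convergent (\<lambda>N. truncated_euler_sum N ss es)"
  using assms
proof (induction ss arbitrary: es)
  case (Cons s ss)
  then obtain e es' where es: "es = e # es'" by (cases es) auto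
  have "convergent (\<lambda>N. truncated_euler_sum N ss es')"
    using Cons es by auto
  then obtain B where B: "\<And>N. \<bar>truncated_euler_sum N ss es'\<bar> \<le> B"
    by (metis convergent_imp_Bseq Bseq_def real_norm_def)
  show ?case
  proof (rule convergent_if_increments_le_inverse_square)
    fix N
    have "e = 1 \<or> e = -1" using Cons.prems es by auto
    hence e: "\<bar>e ^ Suc N\<bar> = 1" by (auto simp: power_abs)
    have "real (Suc N) ^ 2 \<le> real (Suc N) ^ s"
      using Cons.prems by (intro power_increasing) auto
    hence "\<bar>e ^ Suc N / real (Suc N) ^ s * truncated_euler_sum N ss es'\<bar> \<le> 1 / real (Suc N) ^ 2 * B"
      unfolding abs_mult abs_divide e using B by (intro mult_mono frac_le) auto
    thus "\<bar>truncated_euler_sum (Suc N) (s # ss) es - truncated_euler_sum N (s # ss) es\<bar>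
            \<le> B / real (Suc N) ^ 2"
      by (simp add: es truncated_euler_sum_Suc_Cons)
  qed
qed (simp add: convergent_const)

lemma truncated_euler_sum_tendsto:
  assumes "length es = length ss" "set es \<subseteq> {1, -1}" "\<forall>s\<in>set ss. 2 \<le> s"
  shows "(\<lambda>N. truncated_euler_sum N ss es) \<longlonglongrightarrow> euler_sum ss es"
  using convergent_truncated_euler_sum[OF assms]
  by (simp add: convergent_LIMSEQ_iff euler_sum_def truncated_euler_sum_def)

definition compositions :: "nat \<Rightarrow> nat \<Rightarrow> nat list set" where
  "compositions n d = {js. length js = d \<and> (\<forall>j\<in>set js. 0 < j) \<and> sum_list js = n}"

definition signs :: "nat \<Rightarrow> nat \<Rightarrow> real list set" where
  "signs \<alpha> d = {es. length es = d \<and> set es \<subseteq> {1, -1} \<and> count_list es (-1) = \<alpha>}"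

lemma finite_compositions [simp, intro]: "finite (compositions n d)"
  by (rule finite_subset[OF _ finite_lists_length_eq[of "{0..n}" d]])
     (auto simp: compositions_def member_le_sum_list)

lemma finite_signs [simp, intro]: "finite (signs \<alpha> d)"
  by (rule finite_subset[OF _ finite_lists_length_eq[of "{1,-1}" d]]) (auto simp: signs_def)

lemma compositions_0: "compositions n 0 = (if n = 0 then {[]} else {})"
  by (auto simp: compositions_def)

lemma compositions_Suc:
  "compositions n (Suc d) = (\<Union>j\<in>{1..n}. (#) j ` compositions (n - j) d)"
proof (intro equalityI subsetI)
  fix js assume js: "js \<in> compositions n (Suc d)"
  then obtain j js' where "js = j # js'" by (auto simp: compositions_def length_Suc_conv)
  with js show "js \<in> (\<Union>j\<in>{1..n}. (#) j ` compositions (n - j) d)"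
    by (auto simp: compositions_def intro!: bexI[of _ j])
qed (auto simp: compositions_def)

lemma length_le_sum_list_pos: "\<forall>j\<in>set js. 0 < (j :: nat) \<Longrightarrow> length js \<le> sum_list js"
  by (induction js) auto

lemma compositions_empty: "n < d \<Longrightarrow> compositions n d = {}"
  using length_le_sum_list_pos by (fastforce simp: compositions_def)

lemma sum_compositions_Suc:
  "(\<Sum>js\<in>compositions n (Suc d). f js) =
     (\<Sum>j\<in>{1..n}. \<Sum>js\<in>compositions (n - j) d. f (j # js))"
proof -
  have "sum f (\<Union>j\<in>{1..n}. (#) j ` compositions (n - j) d) =
          (\<Sum>j\<in>{1..n}. sum f ((#) j ` compositions (n - j) d))"
    by (rule sum.UNION_disjoint) auto
  also have "\<dots> = (\<Sum>j\<in>{1..n}. \<Sum>js\<in>compositions (n - j) d. f (j # js))"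
    by (simp add: sum.reindex)
  finally show ?thesis by (simp only: compositions_Suc)
qed

lemma signs_0: "signs \<alpha> 0 = (if \<alpha> = 0 then {[]} else {})"
  by (auto simp: signs_def)

lemma signs_Suc:
  "signs \<alpha> (Suc d) = (#) 1 ` signs \<alpha> d \<union> (if \<alpha> = 0 then {} else (#) (-1) ` signs (\<alpha> - 1) d)"
  (is "_ = ?R")
proof (intro equalityI subsetI)
  fix es assume es: "es \<in> signs \<alpha> (Suc d)"
  then obtain e es' where e: "es = e # es'" by (auto simp: signs_def length_Suc_conv)
  hence "e = 1 \<or> e = -1" using es by (auto simp: signs_def)
  with es e show "es \<in> ?R"
    by (auto simp: signs_def)
qed (auto simp: signs_def split: if_splits)

lemma sum_signs_Suc:
  "(\<Sum>es\<in>signs \<alpha> (Suc d). f es) =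
     (\<Sum>es\<in>signs \<alpha> d. f (1 # es)) +
     (if \<alpha> = 0 then 0 else \<Sum>es\<in>signs (\<alpha> - 1) d. f (-1 # es))"
proof -
  have "sum f (signs \<alpha> (Suc d)) = sum f ((#) 1 ` signs \<alpha> d) +
          sum f (if \<alpha> = 0 then {} else (#) (-1) ` signs (\<alpha> - 1) d)"
    unfolding signs_Suc by (intro sum.union_disjoint) (auto split: if_splits)
  thus ?thesis
    by (simp add: sum.reindex inj_on_def split: if_splits)
qed

definition truncated_euler_A :: "nat \<Rightarrow> nat \<Rightarrow> nat \<Rightarrow> nat \<Rightarrow> real" where
  "truncated_euler_A N \<alpha> n d =
     (\<Sum>js\<in>compositions n d. \<Sum>es\<in>signs \<alpha> d. truncated_euler_sum N (map (\<lambda>j. 2 * j) js) es)"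

lemma truncated_euler_A_tendsto:
  "(\<lambda>N. truncated_euler_A N \<alpha> n d) \<longlonglongrightarrow> euler_A \<alpha> (2 * n) d"
proof -
  have comp: "{js. length js = d \<and> (\<forall>j\<in>set js. 0 < j) \<and> 2 * sum_list js = 2 * n} = compositions n d"
    by (auto simp: compositions_def)
  show ?thesis
    unfolding truncated_euler_A_def euler_A_def comp signs_def[symmetric]
  proof (intro tendsto_sum truncated_euler_sum_tendsto ballI)
    fix js es s
    assume js: "js \<in> compositions n d" and es: "es \<in> signs \<alpha> d"
    show "length es = length (map ((*) 2) js)" "set es \<subseteq> {1, -1}"
      using js es by (simp_all add: compositions_def signs_def)
    assume "s \<in> set (map ((*) 2) js)"
    then obtain j where "j \<in> set js" "s = 2 * j" by auto
    with js show "2 \<le> s" by (auto simp: compositions_def)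
  qed
qed

lemma truncated_euler_A_0_right:
  "truncated_euler_A N \<alpha> n 0 = (if n = 0 \<and> \<alpha> = 0 then 1 else 0)"
  by (simp add: truncated_euler_A_def compositions_0 signs_0)

lemma truncated_euler_A_weight_less_depth: "n < d \<Longrightarrow> truncated_euler_A N \<alpha> n d = 0"
  by (simp add: truncated_euler_A_def compositions_empty)

text \<open>
  Either the largest index \<open>N + 1\<close> is absent, or it comes first and carries an exponent \<open>2j\<close>
  and a sign, which uses up one of the \<open>\<alpha>\<close> negative signs when it is \<open>-1\<close>.
\<close>

lemma truncated_euler_A_Suc_Suc:
  "truncated_euler_A (Suc N) \<alpha> n (Suc d) = truncated_euler_A N \<alpha> n (Suc d) +
     (\<Sum>j=1..n. (1 / real (Suc N) ^ 2) ^ j *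
        (truncated_euler_A N \<alpha> (n - j) d +
         (-1) ^ Suc N * (if \<alpha> = 0 then 0 else truncated_euler_A N (\<alpha> - 1) (n - j) d)))"
proof -
  have coeff: "1 / real (Suc N) ^ (2 * j) = (1 / real (Suc N) ^ 2) ^ j"
    "(-1) ^ Suc N / real (Suc N) ^ (2 * j) = (1 / real (Suc N) ^ 2) ^ j * (-1) ^ Suc N" for j
    by (simp_all only: power_divide power_mult power_one times_divide_eq_left mult_1_left)
  show ?thesis
    unfolding truncated_euler_A_def sum_compositions_Suc sum_signs_Suc list.map
      truncated_euler_sum_Suc_Cons power_one coeff
    by (cases \<alpha>) (simp_all only: sum.distrib distrib_left sum_distrib_left mult.assoc if_True if_False
        refl nat.distinct mult_zero_right add_0_right add_0_left mult_zero_left sum.neutral_const diff_Suc_1 ac_simps)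
qed

lemma truncated_euler_A_0_Suc: "truncated_euler_A 0 \<alpha> n (Suc d) = 0"
  by (simp add: truncated_euler_A_def sum_compositions_Suc)

text \<open>
  There is no strictly decreasing sequence of length \<open>d > N\<close> in \<open>{1..N}\<close>.
\<close>

lemma truncated_euler_A_too_few_indices: "N < d \<Longrightarrow> truncated_euler_A N \<alpha> n d = 0"
proof (induction N arbitrary: d n \<alpha>)
  case 0
  thus ?case by (cases d) (simp_all add: truncated_euler_A_0_Suc)
next
  case (Suc N)
  thus ?case
    by (cases d; cases \<alpha>) (simp_all add: truncated_euler_A_Suc_Suc)
qed

section \<open>The generating function for bounded indices\<close>

abbreviation inv_sq :: "nat \<Rightarrow> real" where
  "inv_sq k \<equiv> 1 / real k ^ 2"

definition depth_fps :: "nat \<Rightarrow> nat \<Rightarrow> nat \<Rightarrow> real fps" where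
  "depth_fps N \<alpha> d = Abs_fps (\<lambda>n. truncated_euler_A N \<alpha> n d)"

text \<open>
  The geometric series \<open>a t / (1 - a t)\<close>; for \<open>a = 1/k\<^sup>2\<close> it is \<open>t / (k\<^sup>2 - t)\<close>.
\<close>

definition power_fps :: "real \<Rightarrow> real fps" where
  "power_fps a = Abs_fps (\<lambda>j. if j = 0 then 0 else a ^ j)"

lemma power_fps_mult: "(1 - fps_const a * fps_X) * power_fps a = fps_const a * fps_X"
proof (rule fps_ext)
  fix n
  have "((1 - fps_const a * fps_X) * power_fps a) $ n =
          power_fps a $ n - a * (if n = 0 then 0 else power_fps a $ (n - 1))"
    by (simp add: left_diff_distrib mult.assoc)
  also have "\<dots> = (fps_const a * fps_X) $ n"
    by (cases n; cases "n - 1") (simp_all add: power_fps_def)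
  finally show "((1 - fps_const a * fps_X) * power_fps a) $ n = (fps_const a * fps_X) $ n" .
qed

text \<open>
  Equivalently \<open>1 + y t / (k\<^sup>2 - t) = (k\<^sup>2 - (1 - y) t) / (k\<^sup>2 - t)\<close>: the depth variable turns into
  the dilation \<open>t \<mapsto> (1 - y) t\<close>.
\<close>

lemma power_fps_factor:
  "(1 - fps_const a * fps_X) + fps_const y * ((1 - fps_const a * fps_X) * power_fps a) =
     1 - fps_const ((1 - y) * a) * fps_X"
  unfolding power_fps_mult by (rule fps_ext) (simp add: algebra_simps)

lemma depth_fps_0_right: "depth_fps N \<alpha> 0 = (if \<alpha> = 0 then 1 else 0)"
  by (rule fps_ext) (simp add: depth_fps_def truncated_euler_A_0_right)

lemma depth_fps_0_Suc: "depth_fps 0 \<alpha> (Suc d) = 0"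
  by (rule fps_ext) (simp add: depth_fps_def truncated_euler_A_0_Suc)

lemma depth_fps_eq_0: "N < d \<Longrightarrow> depth_fps N \<alpha> d = 0"
  by (rule fps_ext) (simp add: depth_fps_def truncated_euler_A_too_few_indices)

lemma depth_fps_Suc_Suc:
  "depth_fps (Suc N) \<alpha> (Suc d) = depth_fps N \<alpha> (Suc d) + power_fps (inv_sq (Suc N)) *
     (depth_fps N \<alpha> d + fps_const ((-1) ^ Suc N) * (if \<alpha> = 0 then 0 else depth_fps N (\<alpha> - 1) d))"
proof (rule fps_ext)
  fix n
  have "(power_fps a * f) $ n = (\<Sum>j=1..n. a ^ j * f $ (n - j))" for a :: real and f :: "real fps"
  proof -
    have "(power_fps a * f) $ n = (\<Sum>j=0..n. if j = 0 then 0 else a ^ j * f $ (n - j))"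
      by (auto simp: fps_mult_nth power_fps_def intro!: sum.cong)
    also have "\<dots> = (\<Sum>j=1..n. a ^ j * f $ (n - j))"
      by (intro sum.mono_neutral_cong_right) auto
    finally show ?thesis .
  qed
  thus "depth_fps (Suc N) \<alpha> (Suc d) $ n = (depth_fps N \<alpha> (Suc d) + power_fps (inv_sq (Suc N)) *
     (depth_fps N \<alpha> d + fps_const ((-1) ^ Suc N) * (if \<alpha> = 0 then 0 else depth_fps N (\<alpha> - 1) d))) $ n"
    by (simp add: depth_fps_def truncated_euler_A_Suc_Suc del: fps_const_neg of_nat_Suc)
qed

text \<open>
  The depth variable \<open>y\<close> is a real number and not a second formal variable, so that the generating
  function stays an element of \<open>real fps\<close>; the depths are separated again by comparing polynomials in \<open>y\<close>.
\<close>

definition gen_fps :: "nat \<Rightarrow> nat \<Rightarrow> real \<Rightarrow> real fps" where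
  "gen_fps N \<alpha> y = (\<Sum>d\<le>N. fps_const (y ^ d) * depth_fps N \<alpha> d)"

lemma gen_fps_0: "gen_fps 0 \<alpha> y = (if \<alpha> = 0 then 1 else 0)"
  by (simp add: gen_fps_def depth_fps_0_right)

lemma gen_fps_Suc:
  "gen_fps (Suc N) \<alpha> y = gen_fps N \<alpha> y + fps_const y * power_fps (inv_sq (Suc N)) *
     (gen_fps N \<alpha> y + fps_const ((-1) ^ Suc N) * (if \<alpha> = 0 then 0 else gen_fps N (\<alpha> - 1) y))"
proof -
  let ?g = "power_fps (inv_sq (Suc N))" and ?e = "fps_const ((-1) ^ Suc N) :: real fps"
  let ?f = "\<lambda>d. if \<alpha> = 0 then 0 else depth_fps N (\<alpha> - 1) d"
  have lower: "(\<Sum>d\<le>N. fps_const (y ^ d) * ?f d) = (if \<alpha> = 0 then 0 else gen_fps N (\<alpha> - 1) y)"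
    by (simp add: gen_fps_def)
  have old: "gen_fps N \<alpha> y = depth_fps N \<alpha> 0 +
               (\<Sum>d\<le>N. fps_const (y ^ Suc d) * depth_fps N \<alpha> (Suc d))"
  proof -
    have "gen_fps N \<alpha> y = (\<Sum>d\<le>Suc N. fps_const (y ^ d) * depth_fps N \<alpha> d)"
      by (simp add: gen_fps_def depth_fps_eq_0)
    thus ?thesis by (simp only: sum.atMost_Suc_shift) simp
  qed
  have "gen_fps (Suc N) \<alpha> y = depth_fps (Suc N) \<alpha> 0 +
          (\<Sum>d\<le>N. fps_const (y ^ Suc d) * depth_fps (Suc N) \<alpha> (Suc d))"
    unfolding gen_fps_def by (simp only: sum.atMost_Suc_shift) simp
  also have "depth_fps (Suc N) \<alpha> 0 = depth_fps N \<alpha> 0" by (simp add: depth_fps_0_right)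
  also have "(\<Sum>d\<le>N. fps_const (y ^ Suc d) * depth_fps (Suc N) \<alpha> (Suc d)) =
      (\<Sum>d\<le>N. fps_const (y ^ Suc d) * depth_fps N \<alpha> (Suc d)) +
      fps_const y * ?g * ((\<Sum>d\<le>N. fps_const (y ^ d) * depth_fps N \<alpha> d) +
        ?e * (\<Sum>d\<le>N. fps_const (y ^ d) * ?f d))"
    unfolding depth_fps_Suc_Suc sum_distrib_left sum.distrib [symmetric]
    by (intro sum.cong refl)
       (simp only: power_Suc fps_const_mult[symmetric] distrib_left ac_simps)
  finally show ?thesis
    unfolding lower by (simp only: gen_fps_def[symmetric] old[symmetric] add.assoc[symmetric])
qed

lemma gen_fps_Suc_0:
  "gen_fps (Suc N) 0 y = gen_fps N 0 y + fps_const y * power_fps (inv_sq (Suc N)) * gen_fps N 0 y"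
  using gen_fps_Suc[of N 0 y] by (simp del: of_nat_Suc)

lemma gen_fps_Suc_1:
  "gen_fps (Suc N) 1 y = gen_fps N 1 y + fps_const y * power_fps (inv_sq (Suc N)) *
     (gen_fps N 1 y + fps_const ((-1) ^ Suc N) * gen_fps N 0 y)"
  using gen_fps_Suc[of N 1 y] by (simp del: of_nat_Suc)

text \<open>
  The partial products of \<open>sin(\<pi>x) / (\<pi>x)\<close> in the variable \<open>t = x\<^sup>2\<close>.
\<close>

definition sine_poly :: "nat \<Rightarrow> real fps" where
  "sine_poly N = (\<Prod>k=1..N. 1 - fps_const (inv_sq k) * fps_X)"

definition alt_fps :: "nat \<Rightarrow> real fps" where
  "alt_fps N = (\<Sum>k=1..N. fps_const ((-1) ^ k) * power_fps (inv_sq k))"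

lemma sine_poly_0 [simp]: "sine_poly 0 = 1"
  by (simp add: sine_poly_def)

lemma sine_poly_Suc:
  "sine_poly (Suc N) = (1 - fps_const (inv_sq (Suc N)) * fps_X) * sine_poly N"
  by (simp add: sine_poly_def mult.commute)

lemma sine_poly_alt_fps_Suc:
  "sine_poly (Suc N) * alt_fps (Suc N) = (1 - fps_const (inv_sq (Suc N)) * fps_X) *
     (sine_poly N * alt_fps N) + fps_const ((-1) ^ Suc N) * (fps_const (inv_sq (Suc N)) * fps_X) * sine_poly N"
proof -
  let ?a = "inv_sq (Suc N)"
  have "sine_poly (Suc N) * alt_fps (Suc N) =
    (1 - fps_const ?a * fps_X) * (sine_poly N * alt_fps N) +
     fps_const ((-1) ^ Suc N) * ((1 - fps_const ?a * fps_X) * power_fps ?a) * sine_poly N"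
    unfolding sine_poly_Suc alt_fps_def sum.cl_ivl_Suc by (simp add: algebra_simps del: of_nat_Suc)
  thus ?thesis by (simp only: power_fps_mult)
qed

abbreviation dilate :: "real \<Rightarrow> real fps \<Rightarrow> real fps" where
  "dilate c f \<equiv> f oo (fps_const c * fps_X)"

lemma dilate_simps:
  "dilate c (f + g) = dilate c f + dilate c g"
  "dilate c (f * g) = dilate c f * dilate c g"
  "dilate c (1 - fps_const a * fps_X) = 1 - fps_const (c * a) * fps_X"
  "dilate c fps_X = fps_const c * fps_X"
  by (simp_all add: fps_compose_add_distrib fps_compose_sub_distrib fps_compose_mult_distrib mult_ac
        flip: fps_const_mult)

text \<open>
  Without alternating components the generating function is the product of the factors
  \<open>1 + y t / (k\<^sup>2 - t)\<close>, a quotient of two dilates of the same polynomial.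
\<close>

lemma gen_fps_0_mult_sine_poly:
  "gen_fps N 0 y * sine_poly N = dilate (1 - y) (sine_poly N)"
proof (induction N)
  case (Suc N)
  let ?a = "inv_sq (Suc N)"
  have step: "(H + Y * g * H) * (F * P) = (H * P) * (F + Y * (F * g))" for H Y g F P :: "real fps"
    by (simp add: algebra_simps)
  have "gen_fps (Suc N) 0 y * sine_poly (Suc N) =
     (gen_fps N 0 y * sine_poly N) * (1 - fps_const ((1 - y) * ?a) * fps_X)"
    unfolding gen_fps_Suc_0 sine_poly_Suc step power_fps_factor ..
  also have "\<dots> = dilate (1 - y) (sine_poly (Suc N))"
    unfolding Suc.IH sine_poly_Suc dilate_simps by (rule mult.commute)
  finally show ?case .
qed (simp add: gen_fps_0)

text \<open>
  Both sides satisfy the same recursion in \<open>N\<close>: the factor of the new index multiplies the old series,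
  and the alternating choice of that index multiplies the series without alternating components. The factor
  \<open>1 - y\<close> compensates for the dilation of the numerators of \<open>alt_fps\<close>.
\<close>

lemma gen_fps_1_mult_sine_poly:
  "fps_const (1 - y) * (gen_fps N 1 y * sine_poly N) =
     fps_const y * dilate (1 - y) (sine_poly N * alt_fps N)"
proof (induction N)
  case (Suc N)
  let ?a = "inv_sq (Suc N)" and ?e = "fps_const ((-1) ^ Suc N) :: real fps"
  let ?F = "1 - fps_const ?a * fps_X"
  have step: "C * ((H1 + Y * g * (H1 + e * H0)) * (F * P)) =
      (C * (H1 * P)) * (F + Y * (F * g)) + C * Y * e * (F * g) * (H0 * P)"
    for C H1 Y g e H0 F P :: "real fps"
    by (simp add: algebra_simps)
  have step': "Y * D1 * F' + C * Y * e * (a * X) * D0 = Y * (F' * D1 + e * (C * a * X) * D0)"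
    for Y D1 F' C e a X D0 :: "real fps"
    by (simp add: algebra_simps)
  have "fps_const (1 - y) * (gen_fps (Suc N) 1 y * sine_poly (Suc N)) =
     fps_const y * ((1 - fps_const ((1 - y) * ?a) * fps_X) * dilate (1 - y) (sine_poly N * alt_fps N) +
      ?e * (fps_const (1 - y) * fps_const ?a * fps_X) * dilate (1 - y) (sine_poly N))"
    unfolding gen_fps_Suc_1 sine_poly_Suc step power_fps_factor
      Suc.IH gen_fps_0_mult_sine_poly unfolding power_fps_mult step' ..
  also have "\<dots> = fps_const y * dilate (1 - y) (sine_poly (Suc N) * alt_fps (Suc N))"
    unfolding sine_poly_alt_fps_Suc dilate_simps fps_const_compose by (simp only: mult_ac)
  finally show ?case .
qed (simp add: gen_fps_0 alt_fps_def)

text \<open>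
  The coefficient of \<open>t\<^sup>n\<close> in the preceding lemma, divided by \<open>sine_poly N\<close>. Depths \<open>d > n\<close> contribute nothing,
  so the range of \<open>d\<close> does not grow with \<open>N\<close> and the limit can be taken termwise.
\<close>

lemma truncated_generating_identity:
  assumes "n \<le> N" and Q: "sine_poly N * Q = 1"
  shows "(1 - y) * (\<Sum>d\<le>n. y ^ d * truncated_euler_A N 1 n d) =
     y * (\<Sum>i\<le>n. (1 - y) ^ i * (sine_poly N * alt_fps N) $ i * Q $ (n - i))"
proof -
  have "fps_const (1 - y) * gen_fps N 1 y = fps_const (1 - y) * gen_fps N 1 y * (sine_poly N * Q)"
    by (simp add: Q)
  also have "\<dots> = fps_const (1 - y) * (gen_fps N 1 y * sine_poly N) * Q"
    by (simp only: mult_ac)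
  also have "\<dots> = fps_const y * (dilate (1 - y) (sine_poly N * alt_fps N) * Q)"
    by (simp only: gen_fps_1_mult_sine_poly mult.assoc)
  finally have "(1 - y) * gen_fps N 1 y $ n =
     y * (\<Sum>i\<le>n. (1 - y) ^ i * (sine_poly N * alt_fps N) $ i * Q $ (n - i))"
    unfolding fps_eq_iff fps_mult_left_const_nth
    by (subst (asm) fps_mult_nth) (simp only: fps_nth_compose_linear atLeast0AtMost)
  also have "gen_fps N 1 y $ n = (\<Sum>d\<le>N. y ^ d * truncated_euler_A N 1 n d)"
    by (simp add: gen_fps_def fps_sum_nth depth_fps_def)
  also have "\<dots> = (\<Sum>d\<le>n. y ^ d * truncated_euler_A N 1 n d)"
    using assms by (intro sum.mono_neutral_right) (auto simp: truncated_euler_A_weight_less_depth)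
  finally show ?thesis .
qed

section \<open>The sine product, coefficient by coefficient\<close>

text \<open>
  The series of \<open>sin(\<pi>x) / (\<pi>x)\<close> in \<open>t = x\<^sup>2\<close>.
\<close>

definition sine_fps :: "real fps" where
  "sine_fps = Abs_fps (\<lambda>i. (-1) ^ i * pi ^ (2 * i) / fact (2 * i + 1))"

lemma sine_poly_Suc_nth:
  "sine_poly (Suc N) $ i =
     sine_poly N $ i - inv_sq (Suc N) * (if i = 0 then 0 else sine_poly N $ (i - 1))"
  by (simp add: sine_poly_Suc left_diff_distrib mult.assoc del: of_nat_Suc)

lemma sine_poly_nth_0 [simp]: "sine_poly N $ 0 = 1"
  by (induction N) (simp_all add: sine_poly_Suc_nth)

text \<open>
  The coefficients are bounded by those of \<open>\<Prod>k. 1 + t/k\<^sup>2\<close>, which converges at \<open>t = 2\<close>. The geometric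
  decay makes dominated convergence available for \<open>t \<le> 1\<close>.
\<close>

lemma sine_poly_nth_bound:
  obtains B where "0 \<le> B" "\<And>N i. \<bar>sine_poly N $ i\<bar> \<le> B / 2 ^ i"
proof
  have bound: "\<bar>sine_poly N $ i\<bar> \<le> (\<Prod>k=1..N. 1 + 2 * inv_sq k) / 2 ^ i" (is "_ \<le> ?M N / _") for N i
  proof (induction N arbitrary: i)
    case (Suc N)
    let ?a = "inv_sq (Suc N)"
    have shift: "\<bar>if i = 0 then 0 else sine_poly N $ (i - 1)\<bar> \<le> 2 * ?M N / 2 ^ i"
      using Suc.IH[of "i - 1"] by (cases i) (auto intro!: prod_nonneg)
    have "\<bar>sine_poly (Suc N) $ i\<bar> \<le>
            \<bar>sine_poly N $ i\<bar> + ?a * \<bar>if i = 0 then 0 else sine_poly N $ (i - 1)\<bar>"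
      unfolding sine_poly_Suc_nth by (rule order_trans[OF abs_triangle_ineq4]) (simp add: abs_mult)
    also have "\<dots> \<le> ?M N / 2 ^ i + ?a * (2 * ?M N / 2 ^ i)"
      by (intro add_mono mult_left_mono Suc.IH shift) auto
    also have "\<dots> = ?M (Suc N) / 2 ^ i"
      by (simp add: field_simps del: of_nat_Suc)
    finally show ?case .
  qed simp
  show "\<bar>sine_poly N $ i\<bar> \<le> exp (2 * (pi\<^sup>2 / 6)) / 2 ^ i" for N i
  proof -
    have "(\<Prod>k=1..N. 1 + 2 * inv_sq k) \<le> (\<Prod>k=1..N. exp (2 * inv_sq k))"
      by (intro prod_mono conjI exp_ge_add_one_self) auto
    also have "\<dots> = exp (2 * (\<Sum>k=1..N. inv_sq k))"
      by (simp add: exp_sum sum_distrib_left)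
    also have "(\<Sum>k=1..N. inv_sq k) = (\<Sum>k<N. 1 / (real k + 1)\<^sup>2)"
      by (rule sum.reindex_bij_witness[of _ Suc "\<lambda>k. k - 1"]) auto
    also have "\<dots> \<le> (\<Sum>k. 1 / (real k + 1)\<^sup>2)"
      using inverse_squares_sums by (intro sum_le_suminf) (auto simp: sums_iff add.commute)
    also have "\<dots> = pi\<^sup>2 / 6"
      using inverse_squares_sums by (simp add: sums_iff add.commute)
    finally have "(\<Prod>k=1..N. 1 + 2 * inv_sq k) \<le> exp (2 * (pi\<^sup>2 / 6))"
      by simp
    thus ?thesis
      using bound[of N i] by (meson divide_right_mono order_trans zero_le_numeral zero_le_power)
  qed
qed auto

lemma sine_poly_sums: "(\<lambda>i. sine_poly N $ i * t ^ i) sums (\<Prod>k=1..N. 1 - t * inv_sq k)"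
proof (induction N)
  case 0
  have "(\<lambda>i. if i = 0 then 1 else 0 :: real) sums 1"
    using sums_single[of 0 "\<lambda>_. 1 :: real"] by simp
  also have "(\<lambda>i. if i = 0 then 1 else 0 :: real) = (\<lambda>i. sine_poly 0 $ i * t ^ i)"
    by auto
  finally show ?case by simp
next
  case (Suc N)
  let ?S = "\<Prod>k=1..N. 1 - t * inv_sq k" and ?s = "\<lambda>i. if i = 0 then 0 else sine_poly N $ (i - 1)"
  have "(\<lambda>i. ?s (Suc i) * t ^ Suc i) sums (t * ?S)"
    using sums_mult[OF Suc.IH, of t] by (simp add: mult_ac)
  hence "(\<lambda>i. ?s i * t ^ i) sums (t * ?S)"
    by (subst (asm) sums_Suc_iff) simp
  from sums_diff[OF Suc.IH sums_mult[OF this, of "inv_sq (Suc N)"]] show ?case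
    by (simp add: sine_poly_Suc_nth algebra_simps del: of_nat_Suc)
qed

lemma sine_fps_sums:
  assumes "0 < t"
  shows "(\<lambda>i. sine_fps $ i * t ^ i) sums (sin (pi * sqrt t) / (pi * sqrt t))"
proof -
  have "(-1) ^ i / fact (2 * i + 1) * (pi * sqrt t) ^ (2 * i + 1) / (pi * sqrt t) =
          sine_fps $ i * t ^ i" for i
    using assms by (simp add: sine_fps_def power_mult_distrib power_mult)
  with sums_divide[OF sin_paired[of "pi * sqrt t"], of "pi * sqrt t"] show ?thesis
    by simp
qed

text \<open>
  The series are in \<open>t = x\<^sup>2\<close>, so their values are known for positive \<open>t\<close> only; the zeros of a
  nonzero power series are isolated, so a one-sided neighbourhood suffices.
\<close>

lemma powser_unique_right:
  fixes a b :: "nat \<Rightarrow> real"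
  assumes a: "\<And>t. 0 < t \<Longrightarrow> t \<le> 1 \<Longrightarrow> (\<lambda>i. a i * t ^ i) sums f t"
    and b: "\<And>t. 0 < t \<Longrightarrow> t \<le> 1 \<Longrightarrow> (\<lambda>i. b i * t ^ i) sums f t"
    and zero: "a 0 = b 0"
  shows "a i = b i"
proof (rule ccontr)
  assume "a i \<noteq> b i"
  define h :: "real \<Rightarrow> real" where "h = (\<lambda>t. \<Sum>i. (a i - b i) * t ^ i)"
  have diff: "(\<lambda>i. (a i - b i) * t ^ i) sums 0" if "0 < t" "t \<le> 1" for t
    using sums_diff[OF a[OF that] b[OF that]] by (simp add: left_diff_distrib)
  have "summable (\<lambda>i. (a i - b i) * t ^ i)" if "norm t < 1" for t
    using powser_inside[of "\<lambda>i. a i - b i" 1 t] diff[of 1] that by (auto simp: sums_iff)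
  hence "(\<lambda>i. (a i - b i) * (t - 0) ^ i) sums h t" if "norm (t - 0) < 1" for t
    using that by (simp add: h_def summable_sums)
  moreover have "i > 0" using \<open>a i \<noteq> b i\<close> zero by (cases i) auto
  moreover have "h 0 = 0" using zero by (simp add: h_def)
  ultimately obtain s where s: "0 < s" "\<And>z. z \<in> cball 0 s - {0} \<Longrightarrow> h z \<noteq> 0"
    using powser_0_nonzero[where r = 1 and a = "\<lambda>i. a i - b i" and \<xi> = 0 and f = h and m = i] \<open>a i \<noteq> b i\<close> by auto
  have "h (min s 1) = 0"
    using diff[of "min s 1"] s(1) by (auto simp: h_def sums_iff)
  thus False using s(2)[of "min s 1"] s(1) by auto
qed

text \<open>
  The coefficients converge because their increments are \<open>O(1/N\<^sup>2)\<close>. By Tannery's theorem the limits are the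
  coefficients of a power series whose value is the limit of the products, that is, \<open>sin(\<pi>x) / (\<pi>x)\<close>.
\<close>

lemma sine_poly_tendsto: "(\<lambda>N. sine_poly N $ i) \<longlonglongrightarrow> sine_fps $ i"
proof -
  obtain B where B: "0 \<le> B" "\<And>N i. \<bar>sine_poly N $ i\<bar> \<le> B / 2 ^ i"
    using sine_poly_nth_bound by blast
  define L where "L = (\<lambda>i. lim (\<lambda>N. sine_poly N $ i))"
  have "convergent (\<lambda>N. sine_poly N $ i)" for i
  proof (rule convergent_if_increments_le_inverse_square)
    fix N
    have "B / 2 ^ (i - 1) \<le> B" using B(1) mult_left_mono[of 1 "2 ^ (i - 1)" B]
      by (simp add: divide_le_eq)
    hence "\<bar>if i = 0 then 0 else sine_poly N $ (i - 1)\<bar> \<le> B"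
      using B(1) B(2)[of N "i - 1"] by (auto intro: order_trans)
    thus "\<bar>sine_poly (Suc N) $ i - sine_poly N $ i\<bar> \<le> B / real (Suc N) ^ 2"
      unfolding sine_poly_Suc_nth by (simp add: abs_mult divide_right_mono del: of_nat_Suc)
  qed
  hence L: "(\<lambda>N. sine_poly N $ i) \<longlonglongrightarrow> L i" for i
    by (simp add: L_def convergent_LIMSEQ_iff)
  have "(\<lambda>i. L i * t ^ i) sums (sin (pi * sqrt t) / (pi * sqrt t))" if t: "0 < t" "t \<le> 1" for t
  proof -
    have le: "norm (sine_poly N $ i * t ^ i) \<le> B * (1 / 2) ^ i" for N i
    proof -
      have "\<bar>sine_poly N $ i\<bar> * t ^ i \<le> B / 2 ^ i * 1"
        using t B by (intro mult_mono power_le_one) auto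
      thus ?thesis using t by (simp add: abs_mult power_divide)
    qed
    have geo: "summable (\<lambda>i. B * (1 / 2) ^ i)"
      by (intro summable_mult summable_geometric) simp
    have T: "summable (\<lambda>i. norm (L i * t ^ i)) \<and>
        (\<lambda>N. \<Sum>i. sine_poly N $ i * t ^ i) \<longlonglongrightarrow> (\<Sum>i. L i * t ^ i)"
    proof (rule conjunct2[OF tannerys_theorem])
      show "(\<lambda>N. sine_poly N $ i * t ^ i) \<longlonglongrightarrow> L i * t ^ i" for i
        by (intro tendsto_intros L)
      show "\<forall>\<^sub>F (i, N) in at_top \<times>\<^sub>F sequentially. norm (sine_poly N $ i * t ^ i) \<le> B * (1 / 2) ^ i"
        using le by (intro always_eventually) simp
    qed (use geo in simp_all)
    have eq: "(\<lambda>N. \<Sum>i. sine_poly N $ i * t ^ i) = (\<lambda>N. \<Prod>k=1..N. 1 - (sqrt t)\<^sup>2 / real k ^ 2)"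
      using sine_poly_sums[of _ t] t by (simp add: sums_iff)
    have "(\<lambda>N. \<Prod>k=1..N. 1 - (sqrt t)\<^sup>2 / real k ^ 2) \<longlonglongrightarrow> sin (pi * sqrt t) / (pi * sqrt t)"
      using t by (intro sin_product_formula_real') auto
    hence "(\<Sum>i. L i * t ^ i) = sin (pi * sqrt t) / (pi * sqrt t)"
      by (rule LIMSEQ_unique[OF conjunct2[OF T, unfolded eq]])
    moreover have "summable (\<lambda>i. L i * t ^ i)"
      by (rule summable_norm_cancel[OF conjunct1[OF T]])
    ultimately show ?thesis by (simp add: sums_iff)
  qed
  hence "L i = sine_fps $ i"
  proof (rule powser_unique_right[where f = "\<lambda>t. sin (pi * sqrt t) / (pi * sqrt t)"])
    show "L 0 = sine_fps $ 0"
      by (simp add: L_def sine_fps_def)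
  qed (assumption | erule sine_fps_sums)+
  with L[of i] show ?thesis by simp
qed

section \<open>Cotangent and cosecant\<close>

definition zeta_fps :: "real fps" where
  "zeta_fps = Abs_fps (\<lambda>r. if r = 0 then 0 else zeta_value (2 * r))"

definition zeta_bar_fps :: "real fps" where
  "zeta_bar_fps = Abs_fps (\<lambda>r. if r = 0 then 0 else zeta_bar (2 * r))"

definition power_sum_fps :: "nat \<Rightarrow> real fps" where
  "power_sum_fps N = (\<Sum>k=1..N. power_fps (inv_sq k))"

lemma fps_mult_nth_tendsto:
  fixes f g :: "nat \<Rightarrow> real fps"
  assumes "\<And>i. (\<lambda>N. f N $ i) \<longlonglongrightarrow> f' $ i" "\<And>i. (\<lambda>N. g N $ i) \<longlonglongrightarrow> g' $ i"
  shows "(\<lambda>N. (f N * g N) $ i) \<longlonglongrightarrow> (f' * g') $ i"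
  unfolding fps_mult_nth by (intro tendsto_intros assms)

text \<open>
  A coefficient of the inverse is a polynomial in the earlier coefficients of the inverse and those of
  the series.
\<close>

lemma fps_inverse_nth_tendsto:
  fixes f :: "nat \<Rightarrow> real fps"
  assumes f: "\<And>i. (\<lambda>N. f N $ i) \<longlonglongrightarrow> f' $ i"
    and one: "\<And>N. f N $ 0 = 1"
  shows "(\<lambda>N. inverse (f N) $ i) \<longlonglongrightarrow> inverse f' $ i"
proof (induction i rule: less_induct)
  case (less n)
  have one': "f' $ 0 = 1"
    using LIMSEQ_unique[OF f[of 0], of 1] by (simp add: one)
  have rec: "inverse h $ n = (if n = 0 then 1 else - (\<Sum>i=1..n. h $ i * inverse h $ (n - i)))"
    if "h $ 0 = 1" for h :: "real fps"
  proof (cases "n = 0")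
    case False
    have "h * inverse h = 1" using that by (simp add: inverse_mult_eq_1')
    hence "0 = (h * inverse h) $ n" using False by simp
    also have "\<dots> = h $ 0 * inverse h $ n + (\<Sum>i=1..n. h $ i * inverse h $ (n - i))"
      by (simp add: fps_mult_nth sum.atLeast_Suc_atMost)
    finally show ?thesis using False that by simp
  qed (use that in simp)
  show ?case
  proof (cases "n = 0")
    case True
    thus ?thesis by (simp add: one one')
  next
    case False
    hence "(\<lambda>N. - (\<Sum>i=1..n. f N $ i * inverse (f N) $ (n - i))) \<longlonglongrightarrow>
             - (\<Sum>i=1..n. f' $ i * inverse f' $ (n - i))"
      by (intro tendsto_intros f less.IH) auto
    thus ?thesis
      unfolding rec[OF one] rec[OF one'] using False by simp
  qed
qed

lemma sum_shift_tendsto_suminf: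
  fixes g :: "nat \<Rightarrow> real"
  assumes "summable (\<lambda>k. g (Suc k))"
  shows "(\<lambda>N. \<Sum>k=1..N. g k) \<longlonglongrightarrow> (\<Sum>k. g (Suc k))"
proof -
  have "(\<Sum>k=1..N. g k) = (\<Sum>k<N. g (Suc k))" for N
    by (rule sum.reindex_bij_witness[of _ Suc "\<lambda>k. k - 1"]) auto
  thus ?thesis using summable_LIMSEQ[OF assms] by simp
qed

lemma summable_zeta: "2 \<le> m \<Longrightarrow> summable (\<lambda>k. 1 / real (Suc k) ^ m)"
  using inverse_power_summable[of m, where 'a = real] summable_Suc_iff[of "\<lambda>k. 1 / real k ^ m"]
  by (simp add: inverse_eq_divide power_inverse del: of_nat_Suc)

lemma summable_zeta_bar: "2 \<le> m \<Longrightarrow> summable (\<lambda>k. (-1) ^ Suc k / real (Suc k) ^ m)"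
  by (rule summable_comparison_test[OF _ summable_zeta[of m]])
     (auto simp: power_abs abs_mult simp del: of_nat_Suc intro!: exI[of _ 0])

lemma power_sum_fps_tendsto: "(\<lambda>N. power_sum_fps N $ r) \<longlonglongrightarrow> zeta_fps $ r"
  using sum_shift_tendsto_suminf[OF summable_zeta[of "2 * r"]]
  by (cases "r = 0")
     (simp_all add: power_sum_fps_def zeta_fps_def zeta_value_def fps_sum_nth power_fps_def
        power_divide power_mult del: of_nat_Suc)

lemma alt_fps_tendsto: "(\<lambda>N. alt_fps N $ r) \<longlonglongrightarrow> zeta_bar_fps $ r"
  using sum_shift_tendsto_suminf[of "\<lambda>k. (-1) ^ k / real k ^ (2 * r)"] summable_zeta_bar[of "2 * r"]
  by (cases "r = 0")
     (simp_all add: alt_fps_def zeta_bar_fps_def zeta_bar_def fps_sum_nth power_fps_def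
        power_divide power_mult del: of_nat_Suc power_Suc)

text \<open>
  The logarithmic derivative of the product is the sum of \<open>-1 / (k\<^sup>2 - t)\<close>.
\<close>

lemma sine_poly_log_deriv:
  "fps_X * fps_deriv (sine_poly N) = - (sine_poly N * power_sum_fps N)"
proof (induction N)
  case (Suc N)
  let ?a = "fps_const (inv_sq (Suc N)) * fps_X" and ?g = "power_fps (inv_sq (Suc N))"
  have "fps_X * fps_deriv (sine_poly (Suc N)) =
          (1 - ?a) * (fps_X * fps_deriv (sine_poly N)) - ?a * sine_poly N"
    by (simp add: sine_poly_Suc algebra_simps del: of_nat_Suc)
  also have "\<dots> = - ((1 - ?a) * sine_poly N * power_sum_fps N) - ((1 - ?a) * ?g) * sine_poly N"
    unfolding Suc.IH power_fps_mult by (simp only: mult_minus_right mult.assoc)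
  also have "\<dots> = - (sine_poly (Suc N) * power_sum_fps (Suc N))"
    unfolding sine_poly_Suc power_sum_fps_def sum.cl_ivl_Suc
    by (simp add: algebra_simps del: of_nat_Suc)
  finally show ?case .
qed (simp add: power_sum_fps_def)

lemma sine_fps_log_deriv: "fps_X * fps_deriv sine_fps = - (sine_fps * zeta_fps)"
proof (rule fps_ext)
  fix i
  have "(\<lambda>N. (fps_X * fps_deriv (sine_poly N)) $ i) \<longlonglongrightarrow> (fps_X * fps_deriv sine_fps) $ i"
    by (auto intro!: tendsto_intros sine_poly_tendsto)
  moreover have "(\<lambda>N. (fps_X * fps_deriv (sine_poly N)) $ i) \<longlonglongrightarrow> (- (sine_fps * zeta_fps)) $ i"
    unfolding sine_poly_log_deriv fps_neg_nth
    by (intro tendsto_intros fps_mult_nth_tendsto sine_poly_tendsto power_sum_fps_tendsto)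
  ultimately show "(fps_X * fps_deriv sine_fps) $ i = (- (sine_fps * zeta_fps)) $ i"
    by (rule LIMSEQ_unique)
qed

text \<open>
  The series of \<open>cos(\<pi>x)\<close> in \<open>t = x\<^sup>2\<close>.
\<close>

definition cosine_fps :: "real fps" where
  "cosine_fps = Abs_fps (\<lambda>i. (-1) ^ i * pi ^ (2 * i) / fact (2 * i))"

text \<open>
  This is \<open>\<pi>x cot(\<pi>x) = 1 - 2 \<Sum>r. \<zeta>(2r) x\<^sup>2\<^sup>r\<close>: on coefficients one sees \<open>cosine_fps = P + 2 t P'\<close> for
  \<open>P = sine_fps\<close>, and \<open>t P'\<close> is known from the logarithmic derivative.
\<close>

lemma cosine_fps_eq: "cosine_fps = sine_fps * (1 - 2 * zeta_fps)"
proof -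
  have "cosine_fps $ i = (sine_fps + 2 * (fps_X * fps_deriv sine_fps)) $ i" for i
  proof -
    have "(fps_X * fps_deriv sine_fps) $ i = real i * sine_fps $ i"
      by (cases i) simp_all
    moreover have "(sine_fps + 2 * (fps_X * fps_deriv sine_fps)) $ i =
                     sine_fps $ i + 2 * (fps_X * fps_deriv sine_fps) $ i"
      by (simp only: fps_add_nth fps_mult_numeral_left)
    moreover have "sine_fps $ i + 2 * (real i * sine_fps $ i) = real (2 * i + 1) * sine_fps $ i"
      by (simp add: distrib_right)
    ultimately have "(sine_fps + 2 * (fps_X * fps_deriv sine_fps)) $ i = real (2 * i + 1) * sine_fps $ i"
      by metis
    also have "\<dots> = (-1) ^ i * pi ^ (2 * i) * (real (2 * i + 1) / fact (2 * i + 1))"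
      by (simp add: sine_fps_def)
    also have "real (2 * i + 1) / fact (2 * i + 1) = 1 / fact (2 * i)"
      by (simp del: of_nat_add of_nat_mult)
    finally show ?thesis by (simp add: cosine_fps_def)
  qed
  hence "cosine_fps = sine_fps + 2 * (fps_X * fps_deriv sine_fps)"
    by (rule fps_ext)
  thus ?thesis unfolding sine_fps_log_deriv by (simp add: algebra_simps)
qed

text \<open>
  The way back from \<open>t\<close> to \<open>x\<close>. It is an injective ring homomorphism, so the addition theorems for
  \<open>fps_sin\<close> and \<open>fps_cos\<close> can be used for series in \<open>t\<close>.
\<close>

abbreviation subst_sq :: "real fps \<Rightarrow> real fps" where
  "subst_sq f \<equiv> f oo fps_X ^ 2"

lemma subst_sq_mult: "subst_sq (f * g) = subst_sq f * subst_sq g"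
  by (rule fps_compose_mult_distrib) simp

lemma subst_sq_nth: "subst_sq f $ (2 * k) = f $ k" "subst_sq f $ Suc (2 * k) = 0"
proof -
  have nth: "subst_sq f $ n = (\<Sum>i=0..n. if n = 2 * i then f $ i else 0)" for n
    unfolding fps_compose_nth power_mult[symmetric] by (intro sum.cong refl) simp
  show "subst_sq f $ (2 * k) = f $ k"
    unfolding nth by (subst sum.cong[OF refl, of _ _ "\<lambda>i. if k = i then f $ i else 0"]) auto
  show "subst_sq f $ Suc (2 * k) = 0"
    unfolding nth by (intro sum.neutral ballI) (auto dest: arg_cong[where f = even])
qed

lemma subst_sq_inj: "subst_sq f = subst_sq g \<Longrightarrow> f = g"
  by (rule fps_ext) (metis subst_sq_nth(1))

lemma fps_X_mult_Suc: "(fps_X * f) $ Suc n = f $ n" for f :: "real fps"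
  by simp

lemma double_or_Suc_double:
  fixes n :: nat
  obtains k where "n = 2 * k" | k where "n = Suc (2 * k)"
proof -
  have "n = 2 * (n div 2) \<or> n = Suc (2 * (n div 2))" by arith
  thus thesis using that by blast
qed

lemma fps_sin_eq_subst_sq:
  "fps_sin (pi * s) = fps_const (pi * s) * (fps_X * subst_sq (dilate (s ^ 2) sine_fps))"
proof (rule fps_ext)
  fix n
  show "fps_sin (pi * s) $ n = (fps_const (pi * s) * (fps_X * subst_sq (dilate (s ^ 2) sine_fps))) $ n"
  proof (cases n)
    case n: (Suc m)
    show ?thesis
    proof (cases m rule: double_or_Suc_double)
      case (1 k)
      have "(pi * s) ^ Suc (2 * k) = pi * s * (pi ^ (2 * k) * (s ^ 2) ^ k)"
        by (simp add: power_mult_distrib power_mult)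
      thus ?thesis
        unfolding n 1 fps_mult_left_const_nth fps_X_mult_Suc subst_sq_nth fps_nth_compose_linear
        by (simp add: fps_sin_def sine_fps_def del: power_Suc fact_Suc)
    next
      case (2 k)
      show ?thesis
        unfolding n 2 fps_mult_left_const_nth fps_X_mult_Suc subst_sq_nth
        by (simp add: fps_sin_def)
    qed
  qed simp
qed

lemma fps_cos_eq_subst_sq: "fps_cos (pi * s) = subst_sq (dilate (s ^ 2) cosine_fps)"
proof (rule fps_ext)
  fix n
  show "fps_cos (pi * s) $ n = subst_sq (dilate (s ^ 2) cosine_fps) $ n"
  proof (cases n rule: double_or_Suc_double)
    case (1 k)
    show ?thesis
      unfolding 1 subst_sq_nth fps_nth_compose_linear
      by (simp add: fps_cos_def cosine_fps_def power_mult_distrib power_mult)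
  next
    case (2 k)
    show ?thesis unfolding 2 subst_sq_nth by (simp add: fps_cos_def)
  qed
qed

text \<open>
  Adding the two series cancels the odd-numbered terms and leaves twice the terms with even index.
\<close>

lemma zeta_bar_eq:
  assumes "2 \<le> m"
  shows "zeta_bar m = (2 / 2 ^ m - 1) * zeta_value m"
proof -
  let ?a = "\<lambda>k. 1 / real (Suc k) ^ m"
  have sums: "?a sums zeta_value m" "(\<lambda>k. (-1) ^ Suc k / real (Suc k) ^ m) sums zeta_bar m"
    unfolding zeta_value_def zeta_bar_def
    by (intro summable_sums summable_zeta summable_zeta_bar assms)+
  have "(\<lambda>k. ?a k + (-1) ^ Suc k / real (Suc k) ^ m) sums (zeta_value m + zeta_bar m)"
    by (intro sums_add sums)
  also have "(\<lambda>k. ?a k + (-1) ^ Suc k / real (Suc k) ^ m) =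
               (\<lambda>k. if even k then 0 else 2 * ?a k)"
    by (auto simp: fun_eq_iff)
  finally have "(\<lambda>k. if even k then 0 else 2 * ?a k) sums (zeta_value m + zeta_bar m)" .
  moreover have "strict_mono (\<lambda>k :: nat. 2 * k + 1)" by (auto simp: strict_mono_def)
  moreover have "even n" if "n \<notin> range (\<lambda>k. 2 * k + 1)" for n :: nat
  proof (rule ccontr)
    assume "odd n"
    then obtain k where "n = 2 * k + 1" by (rule oddE)
    thus False using that by blast
  qed
  ultimately have "(\<lambda>k. if even (2 * k + 1) then 0 else 2 * ?a (2 * k + 1)) sums (zeta_value m + zeta_bar m)"
    by (subst sums_mono_reindex) simp_all
  moreover have "(\<lambda>k. if even (2 * k + 1) then 0 else 2 * ?a (2 * k + 1)) = (\<lambda>k. 2 / 2 ^ m * ?a k)"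
  proof
    fix k
    have "real (Suc (2 * k + 1)) = 2 * real (Suc k)" by simp
    thus "(if even (2 * k + 1) then 0 else 2 * ?a (2 * k + 1)) = 2 / 2 ^ m * ?a k"
      by (simp only: power_mult_distrib) simp
  qed
  ultimately have "zeta_value m + zeta_bar m = 2 / 2 ^ m * zeta_value m"
    using sums_mult[OF sums(1), of "2 / 2 ^ m"] by (metis sums_unique2)
  thus ?thesis by (simp add: algebra_simps)
qed

text \<open>
  The formula \<open>sin(\<pi>x) = 2 sin(\<pi>x/2) cos(\<pi>x/2)\<close>; halving \<open>x\<close> dilates \<open>t\<close> by \<open>1/4\<close>.
\<close>

lemma sine_fps_duplication: "sine_fps = dilate (1 / 4) sine_fps * dilate (1 / 4) cosine_fps"
proof -
  let ?S = "dilate (1 / 4) sine_fps" and ?C = "dilate (1 / 4) cosine_fps"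
  have quarter: "(1 / 2 :: real) ^ 2 = 1 / 4" by (simp add: power2_eq_square)
  have half: "2 * fps_const (pi * (1 / 2)) = fps_const pi"
    by (simp add: mult_2)
  have "fps_sin pi = 2 * (fps_sin (pi * (1 / 2)) * fps_cos (pi * (1 / 2)))"
    using fps_sin_add[of "pi / 2" "pi / 2"] by simp
  also have "\<dots> = (2 * fps_const (pi * (1 / 2))) * (fps_X * subst_sq (?S * ?C))"
    unfolding fps_sin_eq_subst_sq fps_cos_eq_subst_sq subst_sq_mult quarter by (simp only: mult.assoc)
  also have "fps_sin pi = fps_const pi * (fps_X * subst_sq sine_fps)"
    using fps_sin_eq_subst_sq[of 1] by simp
  finally have "subst_sq sine_fps = subst_sq (?S * ?C)"
    unfolding half by (simp add: mult.assoc)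
  thus ?thesis by (rule subst_sq_inj)
qed

lemma cosine_fps_duplication: "cosine_fps = 2 * (dilate (1 / 4) cosine_fps) ^ 2 - 1"
proof -
  let ?C = "dilate (1 / 4) cosine_fps"
  have quarter: "(1 / 2 :: real) ^ 2 = 1 / 4" by (simp add: power2_eq_square)
  have "fps_cos pi = fps_cos (pi / 2) ^ 2 - fps_sin (pi / 2) ^ 2"
    using fps_cos_add[of "pi / 2" "pi / 2"] by (simp add: power2_eq_square)
  also have "\<dots> = 2 * fps_cos (pi * (1 / 2)) ^ 2 - 1"
    using fps_sin_cos_sum_of_squares[of "pi / 2"] by (simp add: algebra_simps)
  also have "\<dots> = subst_sq (?C ^ 2 + ?C ^ 2 - 1)"
    unfolding fps_cos_eq_subst_sq quarter power2_eq_square[of "subst_sq ?C"] power2_eq_square[of ?C]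
      fps_compose_sub_distrib fps_compose_add_distrib subst_sq_mult by (simp only: mult_2 fps_compose_1)
  also have "fps_cos pi = subst_sq cosine_fps"
    using fps_cos_eq_subst_sq[of 1] by simp
  finally have "cosine_fps = ?C ^ 2 + ?C ^ 2 - 1" by (rule subst_sq_inj)
  thus ?thesis by (simp only: mult_2)
qed

text \<open>
  The expansion of \<open>\<pi>x / sin(\<pi>x)\<close>, obtained from that of the cotangent by
  \<open>1 / sin(2a) = cot(a) - cot(2a)\<close> with \<open>a = \<pi>x/2\<close>; on coefficients the difference of cotangents is the relation
  between \<open>zeta_bar\<close> and \<open>zeta_value\<close>.
\<close>

lemma sine_fps_mult_cosecant: "sine_fps * (1 - 2 * zeta_bar_fps) = 1"
proof -
  let ?S = "dilate (1 / 4) sine_fps" and ?C = "dilate (1 / 4) cosine_fps" and ?Z = "dilate (1 / 4) zeta_fps"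
  have bar: "1 - 2 * zeta_bar_fps = 2 * (1 - 2 * ?Z) - (1 - 2 * zeta_fps)"
  proof (rule fps_ext)
    fix n
    have "zeta_bar (2 * n) = (2 * (1 / 4) ^ n - 1) * zeta_value (2 * n)" if "n > 0"
      using zeta_bar_eq[of "2 * n"] that by (simp add: power_mult power_divide)
    thus "(1 - 2 * zeta_bar_fps) $ n = (2 * (1 - 2 * ?Z) - (1 - 2 * zeta_fps)) $ n"
      by (cases "n = 0") (simp_all add: zeta_bar_fps_def zeta_fps_def left_diff_distrib right_diff_distrib)
  qed
  have C: "?C = ?S * (1 - 2 * ?Z)"
    unfolding cosine_fps_eq dilate_simps(2) fps_compose_sub_distrib mult_2 dilate_simps(1) fps_compose_1 ..
  have "sine_fps * (1 - 2 * zeta_bar_fps) = ?S * ?C * (2 * (1 - 2 * ?Z)) - sine_fps * (1 - 2 * zeta_fps)"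
    unfolding bar sine_fps_duplication[symmetric] by (rule right_diff_distrib)
  also have "?S * ?C * (2 * (1 - 2 * ?Z)) = 2 * (?C * (?S * (1 - 2 * ?Z)))"
    by (simp only: mult_ac)
  also have "\<dots> = 2 * ?C ^ 2"
    unfolding C[symmetric] power2_eq_square ..
  also have "\<dots> = cosine_fps + 1"
    using cosine_fps_duplication by (simp only: eq_diff_eq)
  finally show ?thesis
    unfolding cosine_fps_eq[symmetric] by (simp only: add_diff_cancel_left')
qed

section \<open>The sums over Euler sums as coefficients\<close>

text \<open>
  The series of \<open>\<pi>x / sin(\<pi>x)\<close> in \<open>t = x\<^sup>2\<close>.
\<close>

definition cosec_fps :: "real fps" where
  "cosec_fps = 1 - 2 * zeta_bar_fps"

lemma inverse_sine_fps: "inverse sine_fps = cosec_fps"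
  using sine_fps_mult_cosecant by (metis cosec_fps_def fps_inverse_unique)

lemma sine_fps_mult_zeta_bar_fps: "sine_fps * zeta_bar_fps = fps_const (1 / 2) * (sine_fps - 1)"
proof -
  have "sine_fps - 1 = sine_fps - sine_fps * (1 - 2 * zeta_bar_fps)"
    by (simp only: sine_fps_mult_cosecant)
  also have "\<dots> = sine_fps * zeta_bar_fps + sine_fps * zeta_bar_fps"
    by (simp add: algebra_simps)
  finally show ?thesis
    by (simp only:) (rule fps_ext, simp)
qed

text \<open>
  The limit of \<open>truncated_generating_identity\<close>. The numerator \<open>P R = (P - 1)/2\<close> has no constant term, so
  the sum starts at \<open>i = 1\<close>.
\<close>

lemma euler_A_1_generating_function:
  "(1 - y) * (\<Sum>d\<le>n. y ^ d * euler_A 1 (2 * n) d) =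
     y * (\<Sum>i=1..n. (1 - y) ^ i * (sine_fps $ i / 2) * cosec_fps $ (n - i))"
proof -
  have inv: "sine_poly N * inverse (sine_poly N) = 1" for N
    by (simp add: inverse_mult_eq_1')
  let ?u = "\<lambda>N. y * (\<Sum>i\<le>n. (1 - y) ^ i * (sine_poly N * alt_fps N) $ i * inverse (sine_poly N) $ (n - i))"
  have "eventually (\<lambda>N. (1 - y) * (\<Sum>d\<le>n. y ^ d * truncated_euler_A N 1 n d) = ?u N) sequentially"
    using eventually_ge_at_top[of n] by eventually_elim (rule truncated_generating_identity[OF _ inv])
  moreover have "(\<lambda>N. (1 - y) * (\<Sum>d\<le>n. y ^ d * truncated_euler_A N 1 n d)) \<longlonglongrightarrow>
          (1 - y) * (\<Sum>d\<le>n. y ^ d * euler_A 1 (2 * n) d)"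
    by (intro tendsto_intros truncated_euler_A_tendsto)
  ultimately have "?u \<longlonglongrightarrow> (1 - y) * (\<Sum>d\<le>n. y ^ d * euler_A 1 (2 * n) d)"
    by (rule Lim_transform_eventually[rotated])
  moreover have "?u \<longlonglongrightarrow> y * (\<Sum>i\<le>n. (1 - y) ^ i * (sine_fps * zeta_bar_fps) $ i * cosec_fps $ (n - i))"
    unfolding inverse_sine_fps[symmetric]
    by (intro tendsto_intros fps_mult_nth_tendsto fps_inverse_nth_tendsto sine_poly_tendsto
          alt_fps_tendsto sine_poly_nth_0)
  ultimately have "(1 - y) * (\<Sum>d\<le>n. y ^ d * euler_A 1 (2 * n) d) =
      y * (\<Sum>i\<le>n. (1 - y) ^ i * (sine_fps * zeta_bar_fps) $ i * cosec_fps $ (n - i))"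
    by (rule LIMSEQ_unique)
  also have "(\<Sum>i\<le>n. (1 - y) ^ i * (sine_fps * zeta_bar_fps) $ i * cosec_fps $ (n - i)) =
               (\<Sum>i=1..n. (1 - y) ^ i * (sine_fps $ i / 2) * cosec_fps $ (n - i))"
    unfolding sine_fps_mult_zeta_bar_fps
    by (intro sum.mono_neutral_cong_right) (auto simp: sine_fps_def not_le)
  finally show ?thesis .
qed

text \<open>
  The preceding lemma is an identity of polynomials in \<open>y\<close>, in which the factor \<open>1 - y\<close> can be
  cancelled; up to sign, the binomial coefficient is the coefficient of \<open>y\<^sup>d\<^sup>-\<^sup>1\<close> in \<open>(1 - y)\<^sup>i\<^sup>-\<^sup>1\<close>.
\<close>

lemma euler_A_1_eq_sum:
  assumes "1 \<le> d" "d \<le> n"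
  shows "euler_A 1 (2 * n) d =
     (-1) ^ (d - 1) / 2 * (\<Sum>i=1..n. real ((i - 1) choose (d - 1)) * sine_fps $ i * cosec_fps $ (n - i))"
proof -
  let ?c = "\<lambda>i. sine_fps $ i / 2 * cosec_fps $ (n - i)"
  define p where "p = (\<Sum>d\<le>n. monom (euler_A 1 (2 * n) d) d)"
  define q where "q = (\<Sum>i=1..n. smult (?c i) ([:1, -1:] ^ (i - 1)))"
  have "poly ([:1, -1:] * p) y = poly ([:1, -1:] * pCons 0 q) y" for y
  proof -
    have "poly ([:1, -1:] * p) y = y * (\<Sum>i=1..n. (1 - y) ^ i * (sine_fps $ i / 2) * cosec_fps $ (n - i))"
      unfolding poly_mult euler_A_1_generating_function[symmetric]
      by (simp add: p_def poly_sum poly_monom mult.commute[of "y ^ _"])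
    also have "(\<Sum>i=1..n. (1 - y) ^ i * (sine_fps $ i / 2) * cosec_fps $ (n - i)) =
                 (\<Sum>i=1..n. (1 - y) * (?c i * (1 - y) ^ (i - 1)))"
      by (intro sum.cong refl) (auto simp: power_eq_if)
    also have "y * \<dots> = (1 - y) * (y * poly q y)"
      unfolding sum_distrib_left[symmetric] by (simp add: q_def poly_sum mult.left_commute)
    also have "\<dots> = poly ([:1, -1:] * pCons 0 q) y"
      unfolding poly_mult by simp
    finally show ?thesis .
  qed
  hence "[:1, -1:] * p = [:1, -1:] * pCons 0 q"
    by (simp add: poly_eq_poly_eq_iff[symmetric] fun_eq_iff)
  hence "p = pCons 0 q" by (simp only: mult_cancel_left) simp
  hence "coeff p d = coeff q (d - 1)"
    using assms by (cases d) simp_all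
  also have "coeff p d = euler_A 1 (2 * n) d"
    using assms by (simp add: p_def coeff_sum)
  also have "coeff q (d - 1) = (\<Sum>i=1..n. ?c i * (real ((i - 1) choose (d - 1)) * (-1) ^ (d - 1)))"
  proof -
    have "coeff ([:1, -1:] ^ m) e = real (m choose e) * (-1) ^ e" for m e
    proof (cases "e \<le> m")
      case False
      have "degree ([:1, -1 :: real:] ^ m) \<le> m" using degree_power_le[of "[:1, -1 :: real:]" m] by simp
      with False show ?thesis by (simp add: coeff_eq_0)
    qed (simp add: coeff_linear_poly_power)
    thus ?thesis by (simp add: q_def coeff_sum)
  qed
  also have "\<dots> = (-1) ^ (d - 1) / 2 *
      (\<Sum>i=1..n. real ((i - 1) choose (d - 1)) * sine_fps $ i * cosec_fps $ (n - i))"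
    unfolding sum_distrib_left by (intro sum.cong) simp_all
  finally show ?thesis .
qed

section \<open>Extracting the binomial coefficients\<close>

text \<open>
  The coefficient of \<open>x\<^sup>2\<^sup>n\<^sup>+\<^sup>1\<close> in \<open>x sin(\<pi>sx) / sin(\<pi>x)\<close>, computed on the left from the product of the
  two series and on the right from the addition theorem for \<open>\<pi>sx = \<pi>x + \<pi>(s-1)x\<close>.
\<close>

lemma sine_quotient_expansion:
  "(\<Sum>i\<le>n. sine_fps $ i * cosec_fps $ (n - i) * s ^ (2 * i + 1)) =
     (-1) ^ n * pi ^ (2 * n) / fact (2 * n) * (s - 1) ^ (2 * n) +
     (\<Sum>j\<le>n. (-1) ^ j * pi ^ (2 * j) / fact (2 * j + 1) * (1 - 2 * zeta_fps) $ (n - j) * (s - 1) ^ (2 * j + 1))"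
proof -
  let ?q = "subst_sq cosec_fps" and ?u = "s - 1"
  have sin1: "fps_sin pi = fps_const pi * (fps_X * subst_sq sine_fps)"
    using fps_sin_eq_subst_sq[of 1] by simp
  have cos1: "fps_cos pi = subst_sq cosine_fps"
    using fps_cos_eq_subst_sq[of 1] by simp
  have one: "sine_fps * cosec_fps = 1"
    unfolding cosec_fps_def by (rule sine_fps_mult_cosecant)
  have cot: "cosine_fps * cosec_fps = 1 - 2 * zeta_fps"
    unfolding cosine_fps_eq using one by (metis mult.assoc mult.commute mult_1)
  have "fps_sin (pi * s) * ?q = fps_sin (pi + pi * ?u) * ?q"
    by (simp add: algebra_simps)
  also have "\<dots> = fps_const pi * fps_X * subst_sq (sine_fps * cosec_fps) * fps_cos (pi * ?u) +
                  subst_sq (cosine_fps * cosec_fps) * fps_sin (pi * ?u)"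
    unfolding fps_sin_add sin1 cos1 subst_sq_mult by (simp only: distrib_left distrib_right mult_ac)
  also have "\<dots> = fps_const pi * (fps_X * subst_sq (dilate (?u ^ 2) cosine_fps +
      fps_const ?u * (dilate (?u ^ 2) sine_fps * (1 - 2 * zeta_fps))))"
    unfolding one cot fps_cos_eq_subst_sq fps_sin_eq_subst_sq
    by (simp only: subst_sq_mult fps_compose_add_distrib fps_const_compose fps_const_mult[symmetric]
        fps_compose_1 distrib_left mult_ac mult_1_left mult_1_right)
  also have "fps_sin (pi * s) * ?q =
      fps_const pi * (fps_X * subst_sq (fps_const s * (dilate (s ^ 2) sine_fps * cosec_fps)))"
    unfolding fps_sin_eq_subst_sq by (simp only: subst_sq_mult fps_const_compose fps_const_mult[symmetric] mult_ac)
  finally have "subst_sq (fps_const s * (dilate (s ^ 2) sine_fps * cosec_fps)) =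
      subst_sq (dilate (?u ^ 2) cosine_fps + fps_const ?u * (dilate (?u ^ 2) sine_fps * (1 - 2 * zeta_fps)))"
    by simp
  from subst_sq_inj[OF this] have coeff: "s * (dilate (s ^ 2) sine_fps * cosec_fps) $ n =
      dilate (?u ^ 2) cosine_fps $ n + ?u * (dilate (?u ^ 2) sine_fps * (1 - 2 * zeta_fps)) $ n"
    by (metis fps_add_nth fps_mult_left_const_nth)
  have nth: "sine_fps $ i = (-1) ^ i * pi ^ (2 * i) / fact (2 * i + 1)"
    "cosine_fps $ i = (-1) ^ i * pi ^ (2 * i) / fact (2 * i)" for i
    by (simp_all add: sine_fps_def cosine_fps_def)
  have pow: "x ^ (2 * i + 1) = x * (x ^ 2) ^ i" "x ^ (2 * i) = (x ^ 2) ^ i" for x :: real and i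
    by (simp_all add: power_mult)
  show ?thesis
    using coeff unfolding fps_mult_nth atLeast0AtMost fps_nth_compose_linear sum_distrib_left nth pow
    by (simp only: times_divide_eq_left times_divide_eq_right mult_ac)
qed

text \<open>
  Both sides of the hypothesis are values of the same polynomial. Arbitrary values \<open>g k\<close> on the
  monomials \<open>s\<^sup>k\<close> define a linear functional, and the conclusion applies it to the two expressions.
\<close>

lemma power_shift_linear_functional:
  fixes a b :: "nat \<Rightarrow> real"
  assumes fin: "finite I" "finite J"
    and eq: "\<And>s. (\<Sum>i\<in>I. a i * s ^ e i) = (\<Sum>j\<in>J. b j * (s - 1) ^ f j)"
  shows "(\<Sum>i\<in>I. a i * g (e i)) =
           (\<Sum>j\<in>J. b j * (\<Sum>k\<le>f j. (-1) ^ (f j - k) * real (f j choose k) * g k))"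
proof -
  define p where "p = (\<Sum>i\<in>I. monom (a i) (e i))"
  define q where "q = (\<Sum>j\<in>J. smult (b j) ([:-1, 1:] ^ f j))"
  have "poly p s = poly q s" for s
    using eq[of s] by (simp add: p_def q_def poly_sum poly_monom)
  hence pq: "p = q" by (simp add: poly_eq_poly_eq_iff[symmetric] fun_eq_iff)
  define D where "D = Max (insert 0 (e ` I \<union> f ` J))"
  have D: "i \<in> I \<Longrightarrow> e i \<le> D" "j \<in> J \<Longrightarrow> f j \<le> D" for i j
    using fin by (auto simp: D_def intro!: Max_ge)
  have "(\<Sum>m\<le>D. coeff p m * g m) = (\<Sum>i\<in>I. \<Sum>m\<le>D. (if m = e i then a i * g m else 0))"
    unfolding p_def coeff_sum sum_distrib_right
    by (subst sum.swap) (auto intro!: sum.cong)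
  also have "\<dots> = (\<Sum>i\<in>I. a i * g (e i))"
    using D by (intro sum.cong refl) (simp add: sum.delta)
  finally have p: "(\<Sum>m\<le>D. coeff p m * g m) = (\<Sum>i\<in>I. a i * g (e i))" .
  have inner: "(\<Sum>m\<le>D. coeff ([:-1, 1:] ^ f j) m * g m) =
      (\<Sum>k\<le>f j. (-1) ^ (f j - k) * real (f j choose k) * g k)" if "j \<in> J" for j
  proof (rule sum.mono_neutral_cong_right)
    show "\<forall>m\<in>{..D} - {..f j}. coeff ([:-1, 1:] ^ f j) m * g m = 0"
    proof
      fix m assume "m \<in> {..D} - {..f j}"
      moreover have "degree ([:-1, 1 :: real:] ^ f j) \<le> f j"
        using degree_power_le[of "[:-1, 1 :: real:]" "f j"] by simp
      ultimately show "coeff ([:-1, 1:] ^ f j) m * g m = 0" by (simp add: coeff_eq_0)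
    qed
  qed (use D(2)[OF that] in \<open>auto simp: coeff_linear_poly_power\<close>)
  have "(\<Sum>m\<le>D. coeff q m * g m) = (\<Sum>j\<in>J. b j * (\<Sum>m\<le>D. coeff ([:-1, 1:] ^ f j) m * g m))"
    unfolding q_def coeff_sum sum_distrib_right sum_distrib_left
    by (subst sum.swap) (simp add: mult.assoc)
  also have "\<dots> = (\<Sum>j\<in>J. b j * (\<Sum>k\<le>f j. (-1) ^ (f j - k) * real (f j choose k) * g k))"
    by (intro sum.cong refl) (simp only: inner)
  finally show ?thesis using p pq by simp
qed

text \<open>
  The sum is the coefficient of \<open>z\<^sup>m\<close> in \<open>(1+z)\<^sup>c ((1+z)\<^sup>h - 1)\<^sup>M\<close>, and the second factor is divisible by
  \<open>z\<^sup>M\<close>.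
\<close>

lemma alternating_binomial_sum_gchoose_eq_0:
  fixes c h :: real
  assumes "m < M"
  shows "(\<Sum>k\<le>M. (-1) ^ (M - k) * real (M choose k) * ((c + real k * h) gchoose m)) = 0"
proof -
  let ?B = "fps_binomial :: real \<Rightarrow> real fps"
  have "(?B h - 1) $ 0 = 0" by simp
  hence low: "(?B h - 1) ^ M $ i = 0" if "i < M" for i
    using startsby_zero_power_prefix that by blast
  have "(?B c * (?B h - 1) ^ M) $ m = 0"
    unfolding fps_mult_nth using assms by (intro sum.neutral) (simp add: low)
  also have "(?B h - 1) ^ M = (\<Sum>k\<le>M. of_nat (M choose k) * ?B h ^ k * (-1) ^ (M - k))"
    using binomial_ring[of "?B h" "-1" M] by simp
  also have "\<dots> = (\<Sum>k\<le>M. fps_const ((-1) ^ (M - k) * real (M choose k)) * ?B (real k * h))"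
  proof (intro sum.cong refl)
    fix k
    have "(-1) ^ (M - k) = (fps_const ((-1) ^ (M - k)) :: real fps)"
      by (metis fps_const_1_eq_1 fps_const_neg fps_const_power)
    thus "of_nat (M choose k) * ?B h ^ k * (-1) ^ (M - k) =
            fps_const ((-1) ^ (M - k) * real (M choose k)) * ?B (real k * h)"
      by (simp only: fps_of_nat[symmetric] fps_binomial_power fps_const_mult[symmetric] mult_ac)
  qed
  also have "?B c * \<dots> = (\<Sum>k\<le>M. fps_const ((-1) ^ (M - k) * real (M choose k)) * ?B (c + real k * h))"
    unfolding fps_binomial_add_mult sum_distrib_left by (simp only: mult_ac)
  finally show ?thesis
    by (simp only: fps_sum_nth fps_mult_left_const_nth fps_binomial_nth)
qed

theorem theorem1p4:
  fixes n d :: nat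
  assumes "1 \<le> d" and "d \<le> n"
  shows "euler_A 1 (2 * n) d =
    zeta_bar (2 * n) -
    (\<Sum>j | int j \<le> \<lfloor>(real d - 2) / 2\<rfloor>. \<Sum>k = 0..2 * j + 1.
       (-1) ^ (d + j + k) / fact (2 * j + 1) * real ((2 * j + 1) choose k) *
       (((real k - 3) / 2) gchoose (d - 1)) *
       zeta_value (2 * n - 2 * j) * pi ^ (2 * j))"
proof -
  define g :: "nat \<Rightarrow> real" where "g = (\<lambda>k. ((real k - 3) / 2) gchoose (d - 1))"
  define \<sigma> :: real where "\<sigma> = (-1) ^ (d - 1)"
  define b where "b = (\<lambda>j. (-1) ^ j * pi ^ (2 * j) / fact (2 * j + 1) * (1 - 2 * zeta_fps) $ (n - j))"
  \<comment> \<open>The right-hand side of \<open>sine_quotient_expansion\<close>: \<open>b j\<close> belongs to \<open>(s-1)\<^sup>2\<^sup>j\<^sup>+\<^sup>1\<close> and \<open>c\<close> to the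
      cosine term \<open>(s-1)\<^sup>2\<^sup>n\<close>, which is given the extra index \<open>n + 1\<close> below. \<open>\<Delta> M\<close> is the value of the
      functional at \<open>(s-1)\<^sup>M\<close>.\<close>
  define c where "c = (-1) ^ n * pi ^ (2 * n) / fact (2 * n)"
  define \<Delta> where "\<Delta> = (\<lambda>M. \<Sum>k\<le>M. (-1) ^ (M - k) * real (M choose k) * g k)"
  have \<sigma>: "\<sigma> * \<sigma> = 1" by (simp add: \<sigma>_def flip: power_add mult_2)

  have \<Delta>_eq_0: "\<Delta> M = 0" if "d - 1 < M" for M
    using alternating_binomial_sum_gchoose_eq_0[OF that, of "-3 / 2" "1 / 2"]
    by (simp add: \<Delta>_def g_def diff_divide_distrib)

  have "(\<Sum>i\<le>n. sine_fps $ i * cosec_fps $ (n - i) * g (2 * i + 1)) =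
          (\<Sum>j\<le>Suc n. (if j \<le> n then b j else c) * \<Delta> (if j \<le> n then 2 * j + 1 else 2 * n))"
    unfolding \<Delta>_def
  proof (rule power_shift_linear_functional)
    fix s :: real
    have "(\<Sum>j\<le>Suc n. (if j \<le> n then b j else c) * (s - 1) ^ (if j \<le> n then 2 * j + 1 else 2 * n)) =
            c * (s - 1) ^ (2 * n) + (\<Sum>j\<le>n. b j * (s - 1) ^ (2 * j + 1))"
      by simp
    thus "(\<Sum>i\<le>n. sine_fps $ i * cosec_fps $ (n - i) * s ^ (2 * i + 1)) =
            (\<Sum>j\<le>Suc n. (if j \<le> n then b j else c) * (s - 1) ^ (if j \<le> n then 2 * j + 1 else 2 * n))"
      by (simp only: sine_quotient_expansion b_def c_def)
  qed simp_all
  also have "\<dots> = (\<Sum>j\<le>n. b j * \<Delta> (2 * j + 1)) + c * \<Delta> (2 * n)"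
    by simp
  also have "\<Delta> (2 * n) = 0"
    using assms by (intro \<Delta>_eq_0) simp
  also have "(\<Sum>j\<le>n. b j * \<Delta> (2 * j + 1)) = (\<Sum>j | 2 * j + 2 \<le> d. b j * \<Delta> (2 * j + 1))"
    using assms by (intro sum.mono_neutral_right) (auto intro!: \<Delta>_eq_0)
  finally have rhs: "(\<Sum>i\<le>n. sine_fps $ i * cosec_fps $ (n - i) * g (2 * i + 1)) =
      (\<Sum>j | 2 * j + 2 \<le> d. b j * \<Delta> (2 * j + 1))"
    by simp

  \<comment> \<open>The term \<open>i = 0\<close>, missing in \<open>euler_A_1_eq_sum\<close>, contributes \<open>zeta_bar (2 * n)\<close>.\<close>
  have g_odd: "g (2 * i + 1) = (if i = 0 then \<sigma> else real ((i - 1) choose (d - 1)))" for i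
  proof (cases "i = 0")
    case True
    have "(-1 :: real) gchoose (d - 1) = \<sigma>"
      using gbinomial_minus[of "1 :: real" "d - 1"] by (simp add: \<sigma>_def gbinomial_of_nat_symmetric)
    thus ?thesis using True by (simp add: g_def)
  next
    case False
    hence "(real (2 * i + 1) - 3) / 2 = real (i - 1)" by (simp add: field_simps)
    thus ?thesis
      unfolding g_def using False by (simp only: binomial_gbinomial if_False)
  qed
  have "(\<Sum>i\<le>n. sine_fps $ i * cosec_fps $ (n - i) * g (2 * i + 1)) =
          \<sigma> * cosec_fps $ n +
          (\<Sum>i=1..n. real ((i - 1) choose (d - 1)) * sine_fps $ i * cosec_fps $ (n - i))"
  proof -
    have "sine_fps $ 0 = 1" by (simp add: sine_fps_def)
    thus ?thesis
      unfolding atMost_atLeast0 g_odd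
      by (subst sum.atLeast_Suc_atMost) (auto intro!: sum.cong)
  qed
  also have "(\<Sum>i=1..n. real ((i - 1) choose (d - 1)) * sine_fps $ i * cosec_fps $ (n - i)) =
               2 * \<sigma> * euler_A 1 (2 * n) d"
  proof -
    have "2 * \<sigma> * (\<sigma> / 2 * x) = \<sigma> * \<sigma> * x" for x by simp
    thus ?thesis
      by (simp only: euler_A_1_eq_sum[OF assms] \<sigma>_def[symmetric] \<sigma> mult_1_left)
  qed
  also have "cosec_fps $ n = - 2 * zeta_bar (2 * n)"
    using assms by (simp add: cosec_fps_def zeta_bar_fps_def)
  finally have "2 * \<sigma> * (euler_A 1 (2 * n) d - zeta_bar (2 * n)) =
      (\<Sum>j | 2 * j + 2 \<le> d. b j * \<Delta> (2 * j + 1))"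
    unfolding rhs by (simp add: algebra_simps)
  hence "\<sigma> * (2 * \<sigma> * (euler_A 1 (2 * n) d - zeta_bar (2 * n))) =
      \<sigma> * (\<Sum>j | 2 * j + 2 \<le> d. b j * \<Delta> (2 * j + 1))"
    by (rule arg_cong)
  moreover have "\<sigma> * (2 * \<sigma> * x) = 2 * x" for x
    using \<sigma> by (metis mult.assoc mult.left_commute mult_1)
  ultimately have "euler_A 1 (2 * n) d =
      zeta_bar (2 * n) - (\<Sum>j | 2 * j + 2 \<le> d. - \<sigma> / 2 * (b j * \<Delta> (2 * j + 1)))"
    unfolding sum_distrib_left[symmetric] by simp
  also have "{j. 2 * j + 2 \<le> d} = {j. int j \<le> \<lfloor>(real d - 2) / 2\<rfloor>}"
    by (auto simp: le_floor_iff field_simps)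
  also have "(\<Sum>j | int j \<le> \<lfloor>(real d - 2) / 2\<rfloor>. - \<sigma> / 2 * (b j * \<Delta> (2 * j + 1))) =
    (\<Sum>j | int j \<le> \<lfloor>(real d - 2) / 2\<rfloor>. \<Sum>k = 0..2 * j + 1.
       (-1) ^ (d + j + k) / fact (2 * j + 1) * real ((2 * j + 1) choose k) *
       (((real k - 3) / 2) gchoose (d - 1)) *
       zeta_value (2 * n - 2 * j) * pi ^ (2 * j))"
  proof (rule sum.cong[OF refl])
    fix j assume "j \<in> {j. int j \<le> \<lfloor>(real d - 2) / 2\<rfloor>}"
    hence "2 * j + 2 \<le> d" by (auto simp: le_floor_iff field_simps)
    hence j: "j < n" using assms by simp
    have b: "b j = (-1) ^ j * pi ^ (2 * j) / fact (2 * j + 1) * (- 2 * zeta_value (2 * n - 2 * j))"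
      using j by (simp add: b_def zeta_fps_def right_diff_distrib')
    have d: "(-1) ^ d = - \<sigma>"
      using assms by (cases d) (simp_all add: \<sigma>_def)
    have sign: "(-1 :: real) ^ (2 * j + 1 - k) = - ((-1) ^ k)" if "k \<le> 2 * j + 1" for k
      using that by (cases "even k") auto
    have "- \<sigma> / 2 * (b j * \<Delta> (2 * j + 1)) = (\<Sum>k=0..2 * j + 1. - \<sigma> / 2 * (b j *
            ((-1) ^ (2 * j + 1 - k) * real ((2 * j + 1) choose k) * g k)))"
      by (simp only: \<Delta>_def sum_distrib_left atMost_atLeast0)
    also have "\<dots> = (\<Sum>k = 0..2 * j + 1.
       (-1) ^ (d + j + k) / fact (2 * j + 1) * real ((2 * j + 1) choose k) * g k *
       zeta_value (2 * n - 2 * j) * pi ^ (2 * j))"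
    proof (intro sum.cong refl)
      fix k assume "k \<in> {0..2 * j + 1}"
      hence "(-1 :: real) ^ (2 * j + 1 - k) = - ((-1) ^ k)" by (intro sign) simp
      thus "- \<sigma> / 2 * (b j * ((-1) ^ (2 * j + 1 - k) * real ((2 * j + 1) choose k) * g k)) =
         (-1) ^ (d + j + k) / fact (2 * j + 1) * real ((2 * j + 1) choose k) * g k *
           zeta_value (2 * n - 2 * j) * pi ^ (2 * j)"
        unfolding b power_add[of _ "d + j"] power_add[of _ d] d
        by (simp only:) (simp add: mult_ac)
    qed
    finally show "- \<sigma> / 2 * (b j * \<Delta> (2 * j + 1)) = (\<Sum>k = 0..2 * j + 1.
       (-1) ^ (d + j + k) / fact (2 * j + 1) * real ((2 * j + 1) choose k) *
       (((real k - 3) / 2) gchoose (d - 1)) *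
       zeta_value (2 * n - 2 * j) * pi ^ (2 * j))"
      by (simp only: g_def)
  qed
  finally show ?thesis .
qed

end
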